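(* Let $d\in\mathbb{N}$ and let $\Phi:\mathbb{M}_d\to\mathbb{M}_d$ be an entanglement breaking CP-map. Then $$(I_d\otimes\Phi(I_d))+\lambda(C_\Phi+C_{\Phi\circ\mathsf{T}})\geq 0,$$ $$(\mathrm{tr}_2(C_\Phi)\otimes I_d)+\lambda(C_\Phi+C_{\mathsf{T}\circ\Phi})\geq 0$$ for all $\lambda\in[-\tfrac12,\infty)$.
   Context: $\mathbb{M}_d$ is the algebra of complex $d\times d$ matrices; a superscript $+$ denotes the cone of positive semidefinite matrices and $A\ge0$ means $A$ is positive semidefinite. CP means completely positive. $X\in(\mathbb{M}_m\otimes\mathbb{M}_n)^+$ is separable if $X=\sum_i A_i\otimes B_i$ (finite sum) with $A_i\in\mathbb{M}_m^+$, $B_i\in\mathbb{M}_n^+$. A linear map $\Phi:\mathbb{M}_d\to\mathbb{M}_d$ is entanglement breaking if $(\mathrm{id}_m\otimes\Phi)(X)$ is separable for all $m\geq1$ and $X\in(\mathbb{M}_m\otimes\mathbb{M}_d)^+$. The Choi matrix of a linear map $\Phi$ is $C_\Phi=\sum_{i,j=1}^d E_{ij}\otimes\Phi(E_{ij})\in\mathbb{M}_d\otimes\mathbb{M}_d$, with $E_{ij}$ the standard matrix units. $\mathsf{T}$ is the transpose map on $\mathbb{M}_d$, $I_d$ the identity matrix, and $\mathrm{tr}_2$ is the linear map with $\mathrm{tr}_2(A\otimes B)=\mathrm{tr}(B)A$. *)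

theory Defs
  imports Jordan_Normal_Form.VS_Connect
begin

abbreviation Mats :: "nat \<Rightarrow> (complex, complex mat) module" where
  "Mats n \<equiv> module_mat TYPE(complex) n n"

definition linear_map_mat :: "nat \<Rightarrow> nat \<Rightarrow> (complex mat \<Rightarrow> complex mat) \<Rightarrow> bool" where
  "linear_map_mat m n \<Phi> \<longleftrightarrow> linear_map class_ring (Mats m) (Mats n) \<Phi>"

lemma linear_map_mat_iff:
  "linear_map_mat m n \<Phi> \<longleftrightarrow>
     (\<forall>A\<in>carrier_mat m m. \<Phi> A \<in> carrier_mat n n) \<and>
     (\<forall>A\<in>carrier_mat m m. \<forall>B\<in>carrier_mat m m. \<Phi> (A + B) = \<Phi> A + \<Phi> B) \<and>
     (\<forall>c. \<forall>A\<in>carrier_mat m m. \<Phi> (c \<cdot>\<^sub>m A) = c \<cdot>\<^sub>m \<Phi> A)"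
proof -
  have vs: "vectorspace class_ring (Mats k)" for k
    by (rule matrix_vs)
  have "linear_map_mat m n \<Phi> \<longleftrightarrow> \<Phi> \<in> LinearCombinations.module_hom class_ring (Mats m) (Mats n)"
    using vs[of m] vs[of n]
    by (auto simp: linear_map_mat_def linear_map_def mod_hom_def mod_hom_axioms_def vectorspace_def)
  then show ?thesis
    by (auto simp: LinearCombinations.module_hom_def module_mat_simps)
qed

text \<open>\<open>A *\<^sub>v v \<bullet>c v\<close> is the number \<open>v\<^sup>* A v\<close>. The order on \<^typ>\<open>complex\<close> is such that
  \<open>0 \<le> z\<close> includes \<open>z\<close> being real, so that hermiticity of \<open>A\<close> is implied.\<close>

definition psd :: "nat \<Rightarrow> complex mat \<Rightarrow> bool" where
  "psd n A \<longleftrightarrow> A \<in> carrier_mat n n \<and> (\<forall>v\<in>carrier_vec n. 0 \<le> (A *\<^sub>v v) \<bullet>c v)"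

text \<open>\<open>\<bbbM>\<^sub>m \<otimes> \<bbbM>\<^sub>n\<close> is identified with the matrices of size \<open>m * n\<close>
  via the Kronecker product; the index pair \<open>(a, i)\<close> becomes \<open>a * n + i\<close>.\<close>

definition kron :: "complex mat \<Rightarrow> complex mat \<Rightarrow> complex mat" (infixl \<open>\<otimes>\<^sub>m\<close> 75) where
  "A \<otimes>\<^sub>m B = mat (dim_row A * dim_row B) (dim_col A * dim_col B)
     (\<lambda>(i, j). A $$ (i div dim_row B, j div dim_col B) * B $$ (i mod dim_row B, j mod dim_col B))"

text \<open>The matrices \<open>X\<^sub>a\<^sub>b\<close> in \<open>X = \<Sum>\<^sub>a\<^sub>b E\<^sub>a\<^sub>b \<otimes> X\<^sub>a\<^sub>b\<close>.\<close>

definition block :: "nat \<Rightarrow> complex mat \<Rightarrow> nat \<Rightarrow> nat \<Rightarrow> complex mat" where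
  "block n X a b = mat n n (\<lambda>(i, j). X $$ (a * n + i, b * n + j))"

text \<open>\<open>id\<^sub>m \<otimes> \<Phi>\<close>, for linear \<open>\<Phi>\<close> from \<open>\<bbbM>\<^sub>d\<close> to \<open>\<bbbM>\<^sub>d\<close>: apply \<open>\<Phi>\<close> to every block.\<close>

definition id_tensor :: "nat \<Rightarrow> nat \<Rightarrow> (complex mat \<Rightarrow> complex mat) \<Rightarrow> complex mat \<Rightarrow> complex mat" where
  "id_tensor m d \<Phi> X = mat (m * d) (m * d)
     (\<lambda>(i, j). \<Phi> (block d X (i div d) (j div d)) $$ (i mod d, j mod d))"

definition mat_trace :: "complex mat \<Rightarrow> complex" where
  "mat_trace A = (\<Sum>i<dim_row A. A $$ (i, i))"

definition tr2 :: "nat \<Rightarrow> nat \<Rightarrow> complex mat \<Rightarrow> complex mat" where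
  "tr2 m n X = mat m m (\<lambda>(a, b). mat_trace (block n X a b))"

lemma mult_add_less:
  fixes a i m n :: nat
  assumes "a < m" "i < n"
  shows "a * n + i < m * n"
proof -
  have "a * n + i < Suc a * n" using assms(2) by simp
  also have "\<dots> \<le> m * n" using assms(1) by (intro mult_le_mono1) simp
  finally show ?thesis .
qed

lemma div_mod_less:
  fixes i m n :: nat
  assumes "i < m * n"
  shows "i div n < m" "i mod n < n"
  using assms by (cases "n = 0"; simp add: less_mult_imp_div_less)+

lemma block_kron:
  assumes "A \<in> carrier_mat m m" "B \<in> carrier_mat n n" "a < m" "b < m"
  shows "block n (A \<otimes>\<^sub>m B) a b = A $$ (a, b) \<cdot>\<^sub>m B"
  using assms by (intro eq_matI) (auto simp: block_def kron_def mult_add_less)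

text \<open>The defining properties of \<open>id\<^sub>m \<otimes> \<Phi>\<close> and \<open>tr\<^sub>2\<close>.\<close>

lemma id_tensor_kron:
  assumes \<Phi>: "linear_map_mat d d \<Phi>" and A: "A \<in> carrier_mat m m" and B: "B \<in> carrier_mat d d"
  shows "id_tensor m d \<Phi> (A \<otimes>\<^sub>m B) = A \<otimes>\<^sub>m \<Phi> B"
proof -
  have \<Phi>B: "\<Phi> B \<in> carrier_mat d d" and sm: "\<Phi> (c \<cdot>\<^sub>m B) = c \<cdot>\<^sub>m \<Phi> B" for c
    using \<Phi> B by (auto simp: linear_map_mat_iff)
  show ?thesis
  proof (rule eq_matI)
    fix i j assume "i < dim_row (A \<otimes>\<^sub>m \<Phi> B)" "j < dim_col (A \<otimes>\<^sub>m \<Phi> B)"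
    then have ij: "i < m * d" "j < m * d"
      using A \<Phi>B by (auto simp: kron_def)
    then show "id_tensor m d \<Phi> (A \<otimes>\<^sub>m B) $$ (i, j) = (A \<otimes>\<^sub>m \<Phi> B) $$ (i, j)"
      using A \<Phi>B block_kron[OF A B div_mod_less(1)[OF ij(1)] div_mod_less(1)[OF ij(2)]]
      by (simp add: id_tensor_def sm div_mod_less) (simp add: kron_def div_mod_less)
  qed (use A \<Phi>B in \<open>auto simp: id_tensor_def kron_def\<close>)
qed

lemma id_tensor_linear:
  assumes \<Phi>: "linear_map_mat d d \<Phi>"
  shows "linear_map_mat (m * d) (m * d) (id_tensor m d \<Phi>)"
proof -
  have bc: "block d X a b \<in> carrier_mat d d" for X a b
    by (simp add: block_def)
  have \<Phi>c: "\<Phi> (block d X a b) \<in> carrier_mat d d" for X a b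
    using \<Phi> bc by (auto simp: linear_map_mat_iff)
  have add: "block d (X + Y) a b = block d X a b + block d Y a b"
    if "Y \<in> carrier_mat (m * d) (m * d)" "a < m" "b < m" for X Y a b
    using that by (intro eq_matI) (auto simp: block_def mult_add_less)
  have sm: "block d (c \<cdot>\<^sub>m X) a b = c \<cdot>\<^sub>m block d X a b"
    if "X \<in> carrier_mat (m * d) (m * d)" "a < m" "b < m" for X c a b
    using that by (intro eq_matI) (auto simp: block_def mult_add_less)
  have lin: "\<Phi> (block d X a b + block d Y a b) = \<Phi> (block d X a b) + \<Phi> (block d Y a b)"
    "\<Phi> (c \<cdot>\<^sub>m block d X a b) = c \<cdot>\<^sub>m \<Phi> (block d X a b)" for X Y a b c
    using \<Phi> bc by (auto simp: linear_map_mat_iff)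
  show ?thesis
    unfolding linear_map_mat_iff
    using \<Phi>c
    by (auto simp: id_tensor_def add sm lin div_mod_less carrier_matD[OF \<Phi>c] intro!: eq_matI)
qed

lemma tr2_kron:
  assumes A: "A \<in> carrier_mat m m" and B: "B \<in> carrier_mat n n"
  shows "tr2 m n (A \<otimes>\<^sub>m B) = mat_trace B \<cdot>\<^sub>m A"
  using A B by (intro eq_matI)
    (auto simp: tr2_def block_kron[OF A B] mat_trace_def sum_distrib_left mult.commute)

lemma tr2_linear:
  assumes "X \<in> carrier_mat (m * n) (m * n)" "Y \<in> carrier_mat (m * n) (m * n)"
  shows "tr2 m n (X + Y) = tr2 m n X + tr2 m n Y" "tr2 m n (c \<cdot>\<^sub>m X) = c \<cdot>\<^sub>m tr2 m n X"
  using assms by (auto simp: tr2_def mat_trace_def block_def mult_add_less sum.distrib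
      sum_distrib_left intro!: eq_matI)

definition separable :: "nat \<Rightarrow> nat \<Rightarrow> complex mat \<Rightarrow> bool" where
  "separable m n X \<longleftrightarrow> (\<exists>(r::nat) A B.
     (\<forall>k<r. psd m (A k) \<and> psd n (B k)) \<and>
     X = (\<Oplus>\<^bsub>Mats (m * n)\<^esub> k \<in> {..<r}. A k \<otimes>\<^sub>m B k))"

definition completely_positive :: "nat \<Rightarrow> (complex mat \<Rightarrow> complex mat) \<Rightarrow> bool" where
  "completely_positive d \<Phi> \<longleftrightarrow> linear_map_mat d d \<Phi> \<and>
     (\<forall>m\<ge>1. \<forall>X. psd (m * d) X \<longrightarrow> psd (m * d) (id_tensor m d \<Phi> X))"

definition entanglement_breaking :: "nat \<Rightarrow> (complex mat \<Rightarrow> complex mat) \<Rightarrow> bool" where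
  "entanglement_breaking d \<Phi> \<longleftrightarrow> linear_map_mat d d \<Phi> \<and>
     (\<forall>m\<ge>1. \<forall>X. psd (m * d) X \<longrightarrow> separable m d (id_tensor m d \<Phi> X))"

definition mat_unit :: "nat \<Rightarrow> nat \<Rightarrow> nat \<Rightarrow> complex mat" where
  "mat_unit d i j = mat d d (\<lambda>(k, l). if k = i \<and> l = j then 1 else 0)"

definition choi :: "nat \<Rightarrow> (complex mat \<Rightarrow> complex mat) \<Rightarrow> complex mat" where
  "choi d \<Phi> = (\<Oplus>\<^bsub>Mats (d * d)\<^esub> i \<in> {..<d}. \<Oplus>\<^bsub>Mats (d * d)\<^esub> j \<in> {..<d}.
     mat_unit d i j \<otimes>\<^sub>m \<Phi> (mat_unit d i j))"

end

theory Submission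
  imports Defs
begin

text \<open>
  Applying \<open>id \<otimes> \<Phi>\<close> to the positive semidefinite matrix \<open>\<Sum>\<^sub>a\<^sub>b E\<^sub>a\<^sub>b \<otimes> E\<^sub>a\<^sub>b\<close> gives the Choi matrix of
  \<open>\<Phi>\<close>. If \<open>\<Phi>\<close> is entanglement breaking, this matrix is therefore separable,
  \<open>C\<^sub>\<Phi> = \<Sum>\<^sub>k A\<^sub>k \<otimes> B\<^sub>k\<close> with \<open>A\<^sub>k, B\<^sub>k \<ge> 0\<close>; in other words
  \<open>\<Phi> X = \<Sum>\<^sub>k tr (A\<^sub>k\<^sup>T X) B\<^sub>k\<close> (\<open>entanglement_breaking_Holevo\<close>). Reading off
  \<open>\<Phi> I = \<Sum>\<^sub>k tr A\<^sub>k B\<^sub>k\<close>, \<open>tr\<^sub>2 C\<^sub>\<Phi> = \<Sum>\<^sub>k tr B\<^sub>k A\<^sub>k\<close>, and the fact that precomposing (postcomposing)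
  with the transposition transposes the \<open>A\<^sub>k\<close> (the \<open>B\<^sub>k\<close>), the two matrices of the theorem become
  \<open>\<Sum>\<^sub>k (tr A\<^sub>k I + \<lambda> (A\<^sub>k + A\<^sub>k\<^sup>T)) \<otimes> B\<^sub>k\<close> and
  \<open>\<Sum>\<^sub>k A\<^sub>k \<otimes> (tr B\<^sub>k I + \<lambda> (B\<^sub>k + B\<^sub>k\<^sup>T))\<close>.

  Every factor is positive semidefinite: for \<open>A \<ge> 0\<close> both \<open>A\<close> and \<open>A\<^sup>T\<close> lie between \<open>0\<close> and
  \<open>tr A I\<close>, so that \<open>A + A\<^sup>T \<le> 2 tr A I\<close> and the value \<open>\<lambda> = - 1/2\<close> is still admissible
  (\<open>psd_trace_plus_transpose\<close>). It remains that Kronecker products of positive semidefinite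
  matrices are positive semidefinite (\<open>psd_kron\<close>). Both this and the trace bound rest on writing a
  positive semidefinite matrix as a sum of rank one matrices \<open>w w\<^sup>*\<close> (\<open>psd_imp_gram\<close>), which is
  obtained by symmetric Gaussian elimination.
\<close>

section \<open>Positive semidefinite matrices as sesquilinear forms\<close>

text \<open>The sesquilinear form \<open>x\<^sup>* A y\<close>. Its arguments are functions rather than vectors of
  dimension \<open>n\<close>, so that test vectors need no carrier conditions.\<close>

definition sesq :: "nat \<Rightarrow> complex mat \<Rightarrow> (nat \<Rightarrow> complex) \<Rightarrow> (nat \<Rightarrow> complex) \<Rightarrow> complex" where
  "sesq n A x y = (\<Sum>i<n. \<Sum>j<n. cnj (x i) * A $$ (i, j) * y j)"

lemma psd_iff_sesq:
  "psd n A \<longleftrightarrow> A \<in> carrier_mat n n \<and> (\<forall>x. 0 \<le> sesq n A x x)"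
proof -
  have form: "(A *\<^sub>v v) \<bullet>c v = sesq n A (\<lambda>i. v $ i) (\<lambda>i. v $ i)"
    if "A \<in> carrier_mat n n" "v \<in> carrier_vec n" for v
    using that by (auto simp: sesq_def scalar_prod_def atLeast0LessThan sum_distrib_left
        sum_distrib_right intro!: sum.cong)
  have "sesq n A x x = sesq n A (\<lambda>i. vec n x $ i) (\<lambda>i. vec n x $ i)" for x
    by (auto simp: sesq_def intro!: sum.cong)
  with form show ?thesis
    unfolding psd_def by (metis vec_carrier)
qed

lemma psd_carrier: "psd n A \<Longrightarrow> A \<in> carrier_mat n n"
  by (simp add: psd_def)

lemma sesq_line:
  "sesq n A (\<lambda>i. x i + c * y i) (\<lambda>i. x i + c * y i) =
     sesq n A x x + c * sesq n A x y + cnj c * sesq n A y x + c * cnj c * sesq n A y y"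
proof -
  have "cnj (x i + c * y i) * A $$ (i, j) * (x j + c * y j) =
      cnj (x i) * A $$ (i, j) * x j + c * (cnj (x i) * A $$ (i, j) * y j)
      + cnj c * (cnj (y i) * A $$ (i, j) * x j) + c * cnj c * (cnj (y i) * A $$ (i, j) * y j)" for i j
    by (simp add: algebra_simps)
  then show ?thesis
    by (simp only: sesq_def sum.distrib sum_distrib_left)
qed

lemma sesq_add_mat:
  assumes "A \<in> carrier_mat n n" "B \<in> carrier_mat n n"
  shows "sesq n (A + B) x y = sesq n A x y + sesq n B x y"
  using assms by (simp add: sesq_def sum.distrib ring_distribs)

lemma sesq_smult_mat:
  assumes "A \<in> carrier_mat n n"
  shows "sesq n (c \<cdot>\<^sub>m A) x y = c * sesq n A x y"
  using assms by (simp add: sesq_def sum_distrib_left ac_simps)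

lemma sesq_transpose:
  assumes "A \<in> carrier_mat n n"
  shows "sesq n (transpose_mat A) x y = sesq n A (\<lambda>i. cnj (y i)) (\<lambda>i. cnj (x i))"
proof -
  have "sesq n (transpose_mat A) x y = (\<Sum>i<n. \<Sum>j<n. cnj (x i) * A $$ (j, i) * y j)"
    using assms by (simp add: sesq_def)
  also have "\<dots> = (\<Sum>j<n. \<Sum>i<n. cnj (x i) * A $$ (j, i) * y j)"
    by (rule sum.swap)
  finally show ?thesis by (simp add: sesq_def ac_simps)
qed

lemma sesq_unit_right:
  assumes "k < n"
  shows "sesq n A x (\<lambda>j. if j = k then 1 else 0) = (\<Sum>i<n. cnj (x i) * A $$ (i, k))"
proof -
  have "cnj (x i) * A $$ (i, j) * (if j = k then 1 else 0)
      = (if j = k then cnj (x i) * A $$ (i, k) else 0)" for i j by simp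
  then show ?thesis using assms by (simp add: sesq_def)
qed

lemma sesq_unit_unit:
  assumes "i < n" "j < n"
  shows "sesq n A (\<lambda>l. if l = i then 1 else 0) (\<lambda>l. if l = j then 1 else 0) = A $$ (i, j)"
proof -
  have "cnj (if l = i then 1 else 0) * A $$ (l, j) = (if l = i then A $$ (i, j) else 0)" for l
    by simp
  then show ?thesis using assms by (simp only: sesq_unit_right) simp
qed

lemma psd_sum_of_psd:
  assumes "M \<in> carrier_mat n n" "\<And>k. k < (r::nat) \<Longrightarrow> psd n (X k)"
    and "\<And>i j. i < n \<Longrightarrow> j < n \<Longrightarrow> M $$ (i, j) = (\<Sum>k<r. X k $$ (i, j))"
  shows "psd n M"
proof -
  have "sesq n M x x = (\<Sum>k<r. sesq n (X k) x x)" for x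
  proof -
    have "sesq n M x x = (\<Sum>i<n. \<Sum>j<n. \<Sum>k<r. cnj (x i) * X k $$ (i, j) * x j)"
      using assms(3) by (simp add: sesq_def sum_distrib_left sum_distrib_right)
    also have "\<dots> = (\<Sum>i<n. \<Sum>k<r. \<Sum>j<n. cnj (x i) * X k $$ (i, j) * x j)"
      by (intro sum.cong refl sum.swap)
    also have "\<dots> = (\<Sum>k<r. sesq n (X k) x x)"
      unfolding sesq_def by (rule sum.swap)
    finally show ?thesis .
  qed
  then show ?thesis using assms(1,2) by (auto simp: psd_iff_sesq intro!: sum_nonneg)
qed

text \<open>The scalar core of the Cauchy--Schwarz inequality. The expression in \<open>c\<close> is
  \<open>q (x + c y)\<close> for a form \<open>q\<close>; that it is real for \<open>c = 1\<close> and \<open>c = \<i>\<close> forces hermitian symmetry,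
  which is how hermiticity is extracted from positivity.\<close>

lemma nonneg_quadratic_discriminant:
  fixes p u v s :: complex
  assumes nonneg: "\<And>c. 0 \<le> p + c * u + cnj c * v + c * cnj c * s" and p: "0 \<le> p" and s: "0 \<le> s"
  shows "v = cnj u" "u * cnj u \<le> p * s"
proof -
  have im: "Im p = 0" "Im s = 0" and re: "0 \<le> Re p" "0 \<le> Re s"
    using p s by (auto simp: less_eq_complex_def)
  show v: "v = cnj u"
    using nonneg[of 1] nonneg[of \<i>] im by (auto simp: less_eq_complex_def complex_eq_iff)
  define r where "r = (Re u)\<^sup>2 + (Im u)\<^sup>2"
  have r: "u * cnj u = complex_of_real r"
    by (simp add: complex_mult_cnj r_def)
  \<comment> \<open>On the line through \<open>cnj u\<close> the discriminant condition becomes one about a real quadratic.\<close>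
  have real: "0 \<le> Re p + 2 * t * r + t\<^sup>2 * r * Re s" for t
    using nonneg[of "complex_of_real t * cnj u"] im
    by (simp add: less_eq_complex_def v r_def algebra_simps power2_eq_square)
  have "r \<le> Re p * Re s"
  proof (cases "Re s = 0")
    case True
    have "r \<le> 0"
    proof (rule ccontr)
      assume "\<not> r \<le> 0"
      \<comment> \<open>Here the quadratic degenerates to \<open>Re p + 2 t r\<close>, which is negative for this \<open>t\<close>.\<close>
      moreover have "0 \<le> Re p + 2 * (- (Re p + 1) / r) * r"
        using real[of "- (Re p + 1) / r"] True by simp
      ultimately have "0 \<le> - Re p - 2" by simp
      then show False using re by simp
    qed
    then show ?thesis using True by simp
  next
    case False
    then have "Re s > 0" using re by simp
    \<comment> \<open>The minimum of the real quadratic.\<close>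
    then show ?thesis using real[of "- 1 / Re s"]
      by (simp add: field_simps power2_eq_square)
  qed
  then show "u * cnj u \<le> p * s"
    using im by (simp add: r less_eq_complex_def)
qed

lemma psd_Cauchy_Schwarz:
  assumes "psd n A"
  shows "sesq n A y x = cnj (sesq n A x y)"
    and "sesq n A x y * cnj (sesq n A x y) \<le> sesq n A x x * sesq n A y y"
proof -
  have pos: "0 \<le> sesq n A z z" for z using assms by (simp add: psd_iff_sesq)
  have "0 \<le> sesq n A x x + c * sesq n A x y + cnj c * sesq n A y x + c * cnj c * sesq n A y y" for c
    using pos[of "\<lambda>i. x i + c * y i"] by (simp only: sesq_line)
  note * = nonneg_quadratic_discriminant[OF this pos pos]
  show "sesq n A y x = cnj (sesq n A x y)"
    and "sesq n A x y * cnj (sesq n A x y) \<le> sesq n A x x * sesq n A y y"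
    by (rule *)+
qed

lemma psd_hermitian:
  assumes "psd n A" "i < n" "j < n"
  shows "A $$ (j, i) = cnj (A $$ (i, j))"
  using psd_Cauchy_Schwarz(1)[OF assms(1), of "\<lambda>l. if l = j then 1 else 0" "\<lambda>l. if l = i then 1 else 0"]
    assms by (simp only: sesq_unit_unit)

lemma psd_minor:
  assumes "psd n A" "i < n" "j < n"
  shows "A $$ (i, j) * cnj (A $$ (i, j)) \<le> A $$ (i, i) * A $$ (j, j)"
  using psd_Cauchy_Schwarz(2)[OF assms(1), of "\<lambda>l. if l = i then 1 else 0" "\<lambda>l. if l = j then 1 else 0"]
    assms by (simp only: sesq_unit_unit)

lemma psd_diag_nonneg:
  assumes "psd n A" "i < n"
  shows "0 \<le> A $$ (i, i)"
proof -
  have "0 \<le> sesq n A (\<lambda>l. if l = i then 1 else 0) (\<lambda>l. if l = i then 1 else 0)"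
    using assms by (simp add: psd_iff_sesq)
  then show ?thesis using assms by (simp only: sesq_unit_unit)
qed

section \<open>Gram representation and tensor products\<close>

lemma sesq_gram:
  assumes "\<And>i j. i < n \<Longrightarrow> j < n \<Longrightarrow> A $$ (i, j) = (\<Sum>k\<in>K. w k i * cnj (w k j))"
  shows "sesq n A x y = (\<Sum>k\<in>K. (\<Sum>i<n. cnj (x i) * w k i) * cnj (\<Sum>i<n. cnj (y i) * w k i))"
proof -
  have "sesq n A x y = (\<Sum>i<n. \<Sum>j<n. \<Sum>k\<in>K. cnj (x i) * w k i * (cnj (w k j) * y j))"
    using assms by (simp add: sesq_def sum_distrib_left sum_distrib_right algebra_simps)
  also have "\<dots> = (\<Sum>i<n. \<Sum>k\<in>K. \<Sum>j<n. cnj (x i) * w k i * (cnj (w k j) * y j))"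
    by (intro sum.cong refl sum.swap)
  also have "\<dots> = (\<Sum>k\<in>K. \<Sum>i<n. \<Sum>j<n. cnj (x i) * w k i * (cnj (w k j) * y j))"
    by (rule sum.swap)
  also have "\<dots> = (\<Sum>k\<in>K. (\<Sum>i<n. cnj (x i) * w k i) * cnj (\<Sum>i<n. cnj (y i) * w k i))"
    by (simp only: sum_product cnj_sum complex_cnj_mult complex_cnj_cnj mult.commute[of "y _"])
  finally show ?thesis .
qed

text \<open>The form of a Gram matrix is a sum of terms \<open>z * cnj z\<close>. The index set is arbitrary, which
  allows pairs as indices for Kronecker products.\<close>

lemma gram_imp_psd:
  assumes "A \<in> carrier_mat n n"
    and "\<And>i j. i < n \<Longrightarrow> j < n \<Longrightarrow> A $$ (i, j) = (\<Sum>k\<in>K. w k i * cnj (w k j))"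
  shows "psd n A"
proof -
  have "0 \<le> z * cnj z" for z
    using conjugate_square_positive[of z] by simp
  then have "0 \<le> sesq n A x x" for x
    by (subst sesq_gram[where w = w and K = K]) (auto simp only: assms(2) intro!: sum_nonneg)
  then show ?thesis using assms(1) by (simp add: psd_iff_sesq)
qed

lemma psd_one: "psd n (1\<^sub>m n)"
proof (rule gram_imp_psd)
  fix i j :: nat assume "i < n" "j < n"
  have "(if i = k then 1 else 0) * cnj (if j = k then 1 else 0)
      = (if k = i then (if i = j then 1 else 0) else 0)" for k by simp
  then show "1\<^sub>m n $$ (i, j)
      = (\<Sum>k\<in>{..<n}. (if i = k then 1 else 0) * cnj (if j = k then 1 else 0))"
    using \<open>i < n\<close> \<open>j < n\<close> by (simp only:) simp
qed simp

text \<open>One step of symmetric Gaussian elimination with pivot \<open>k\<close>: subtracting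
  \<open>A e\<^sub>k (A e\<^sub>k)\<^sup>* / A\<^sub>k\<^sub>k\<close> changes the form by \<open>- \<bar>x\<^sup>* A e\<^sub>k\<bar>\<^sup>2 / A\<^sub>k\<^sub>k\<close>, and the Cauchy--Schwarz
  inequality bounds this correction by \<open>x\<^sup>* A x\<close>. If the pivot vanishes, so does the correction
  because division by \<open>0\<close> yields \<open>0\<close>.\<close>

lemma psd_eliminate:
  assumes A: "psd n A" and k: "k < n"
  shows "psd n (mat n n (\<lambda>(i, j). A $$ (i, j) - A $$ (i, k) * cnj (A $$ (j, k)) / A $$ (k, k)))"
    (is "psd n ?B")
proof (cases "A $$ (k, k) = 0")
  case True
  then have "?B = A" using psd_carrier[OF A] by (intro eq_matI) auto
  then show ?thesis using A by simp
next
  case False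
  define a where "a = A $$ (k, k)"
  have a: "a = complex_of_real (Re a)" "Re a > 0"
    using psd_diag_nonneg[OF A k] False
    by (auto simp: a_def less_eq_complex_def complex_eq_iff order_less_le)
  have "0 \<le> sesq n ?B x x" for x
  proof -
    define u where "u = (\<Sum>i<n. cnj (x i) * A $$ (i, k))"
    have "u * cnj u = (\<Sum>i<n. \<Sum>j<n. cnj (x i) * A $$ (i, k) * (x j * cnj (A $$ (j, k))))"
      by (simp add: u_def sum_product)
    then have eq: "sesq n ?B x x = sesq n A x x - u * cnj u / a"
      by (simp add: sesq_def a_def sum_subtractf [symmetric] sum_divide_distrib field_simps)
    have "u * cnj u \<le> sesq n A x x * a"
      using psd_Cauchy_Schwarz(2)[OF A, of x "\<lambda>l. if l = k then 1 else 0"]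
      unfolding sesq_unit_unit[OF k k] sesq_unit_right[OF k] u_def a_def .
    then have "0 \<le> (sesq n A x x * a - u * cnj u) / complex_of_real (Re a)"
      using a(2) by (simp add: less_eq_complex_def Re_divide_of_real Im_divide_of_real)
    then have "0 \<le> (sesq n A x x * a - u * cnj u) / a"
      using a(1) by simp
    moreover have "(sesq n A x x * a - u * cnj u) / a = sesq n A x x - u * cnj u / a"
      using False by (simp add: a_def diff_divide_distrib)
    ultimately show ?thesis by (simp only: eq)
  qed
  then show ?thesis by (simp add: psd_iff_sesq)
qed

text \<open>Eliminating the indices from the last to the first peels off one rank one matrix per step.
  The induction is on the number \<open>k\<close> of indices that are left; rows beyond \<open>k\<close> are zero already.
  A vanishing pivot is harmless, since positivity of the \<open>2 \<times> 2\<close> minors then makes its whole column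
  zero.\<close>

lemma psd_imp_gram:
  assumes "psd n A"
  obtains w :: "nat \<Rightarrow> nat \<Rightarrow> complex"
  where "\<And>i j. i < n \<Longrightarrow> j < n \<Longrightarrow> A $$ (i, j) = (\<Sum>k<n. w k i * cnj (w k j))"
proof -
  have "\<exists>w. \<forall>i<n. \<forall>j<n. A $$ (i, j) = (\<Sum>l<k. w l i * cnj (w l j))"
    if "k \<le> n" "psd n A" "\<And>i j. i < n \<Longrightarrow> j < n \<Longrightarrow> k \<le> i \<Longrightarrow> A $$ (i, j) = 0" for k
    using that
  proof (induction k arbitrary: A)
    case 0
    then show ?case by auto
  next
    case (Suc k)
    then have k: "k < n" and A: "psd n A" by auto
    define a where "a = A $$ (k, k)"
    define s where "s = complex_of_real (sqrt (Re a))"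
    have a: "0 \<le> Re a" "Im a = 0"
      using psd_diag_nonneg[OF A k] by (auto simp: a_def less_eq_complex_def)
    have s: "s * s = a" "cnj s = s"
      using a by (auto simp: s_def complex_eq_iff)
    let ?B = "mat n n (\<lambda>(i, j). A $$ (i, j) - A $$ (i, k) * cnj (A $$ (j, k)) / A $$ (k, k))"
    have pivot: "A $$ (i, k) = 0" if "i < n" "a = 0" for i
      using psd_minor[OF A \<open>i < n\<close> k] that(2)
      by (auto simp: a_def complex_mult_cnj less_eq_complex_def sum_power2_le_zero_iff complex_eq_iff)
    have "?B $$ (i, j) = 0" if ij: "i < n" "j < n" "k \<le> i" for i j
    proof (cases "i = k")
      case True
      then show ?thesis
        using ij psd_hermitian[OF A k \<open>j < n\<close>] psd_hermitian[OF A k k] pivot[of j]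
        by (cases "a = 0") (auto simp: a_def)
    next
      case False
      then show ?thesis using ij Suc.prems(3) k by auto
    qed
    from Suc.IH[OF _ psd_eliminate[OF A k] this] k obtain w
      where w: "\<And>i j. i < n \<Longrightarrow> j < n \<Longrightarrow> ?B $$ (i, j) = (\<Sum>l<k. w l i * cnj (w l j))"
      by auto
    define w' where "w' l = (if l = k then (\<lambda>i. A $$ (i, k) / s) else w l)" for l
    have "A $$ (i, j) = (\<Sum>l<Suc k. w' l i * cnj (w' l j))" if "i < n" "j < n" for i j
      using w[OF that] that s by (simp add: w'_def a_def diff_eq_eq)
    then show ?case by blast
  qed
  from this[of n] assms that show ?thesis by fastforce
qed

text \<open>If \<open>A = \<Sum>\<^sub>k w\<^sub>k w\<^sub>k\<^sup>*\<close> and \<open>B = \<Sum>\<^sub>l z\<^sub>l z\<^sub>l\<^sup>*\<close>, then \<open>A \<otimes> B\<close> is the Gram matrix of the vectors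
  \<open>w\<^sub>k \<otimes> z\<^sub>l\<close>.\<close>

lemma psd_kron:
  assumes A: "psd m A" and B: "psd n B"
  shows "psd (m * n) (A \<otimes>\<^sub>m B)"
proof -
  obtain w where w: "\<And>i j. i < m \<Longrightarrow> j < m \<Longrightarrow> A $$ (i, j) = (\<Sum>k<m. w k i * cnj (w k j))"
    using psd_imp_gram[OF A] by blast
  obtain z where z: "\<And>i j. i < n \<Longrightarrow> j < n \<Longrightarrow> B $$ (i, j) = (\<Sum>k<n. z k i * cnj (z k j))"
    using psd_imp_gram[OF B] by blast
  note car = psd_carrier[OF A] psd_carrier[OF B]
  show ?thesis
  proof (rule gram_imp_psd)
    show "A \<otimes>\<^sub>m B \<in> carrier_mat (m * n) (m * n)"
      using car by (auto simp: kron_def)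
    fix p q assume pq: "p < m * n" "q < m * n"
    have "(A \<otimes>\<^sub>m B) $$ (p, q) = A $$ (p div n, q div n) * B $$ (p mod n, q mod n)"
      using car pq by (simp add: kron_def)
    also have "\<dots> = (\<Sum>k<m. \<Sum>l<n. (w k (p div n) * z l (p mod n))
        * cnj (w k (q div n) * z l (q mod n)))"
      unfolding w[OF div_mod_less(1)[OF pq(1)] div_mod_less(1)[OF pq(2)]]
        z[OF div_mod_less(2)[OF pq(1)] div_mod_less(2)[OF pq(2)]] sum_product
      by (intro sum.cong refl) simp
    also have "\<dots> = (\<Sum>(k, l)\<in>{..<m} \<times> {..<n}. (w k (p div n) * z l (p mod n))
        * cnj (w k (q div n) * z l (q mod n)))"
      by (rule sum.cartesian_product)
    finally show "(A \<otimes>\<^sub>m B) $$ (p, q) = (\<Sum>e\<in>{..<m} \<times> {..<n}.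
        (\<lambda>(k, l) p. w k (p div n) * z l (p mod n)) e p
          * cnj ((\<lambda>(k, l) p. w k (p div n) * z l (p mod n)) e q))"
      by (simp add: case_prod_beta)
  qed
qed

section \<open>The trace bound\<close>

lemma sesq_one: "sesq n (1\<^sub>m n) x y = (\<Sum>i<n. cnj (x i) * y i)"
proof -
  have "cnj (x i) * 1\<^sub>m n $$ (i, j) * y j = (if j = i then cnj (x i) * y i else 0)"
    if "i < n" "j < n" for i j using that by simp
  then show ?thesis by (simp add: sesq_def)
qed

text \<open>The inequality \<open>A \<le> tr A I\<close> without eigenvalues: for \<open>A = \<Sum>\<^sub>k w\<^sub>k w\<^sub>k\<^sup>*\<close> the trace is
  \<open>\<Sum>\<^sub>k \<parallel>w\<^sub>k\<parallel>\<^sup>2\<close>, and each \<open>\<bar>x\<^sup>* w\<^sub>k\<bar>\<^sup>2\<close> is at most \<open>\<parallel>x\<parallel>\<^sup>2 \<parallel>w\<^sub>k\<parallel>\<^sup>2\<close> by the Cauchy--Schwarz inequality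
  for the form of the identity matrix.\<close>

lemma sesq_le_trace:
  assumes A: "psd n A"
  shows "sesq n A x x \<le> mat_trace A * sesq n (1\<^sub>m n) x x"
proof -
  obtain w where w: "\<And>i j. i < n \<Longrightarrow> j < n \<Longrightarrow> A $$ (i, j) = (\<Sum>k<n. w k i * cnj (w k j))"
    using psd_imp_gram[OF A] by blast
  have "mat_trace A = (\<Sum>i<n. \<Sum>k<n. w k i * cnj (w k i))"
    using psd_carrier[OF A] w by (simp add: mat_trace_def)
  also have "\<dots> = (\<Sum>k<n. sesq n (1\<^sub>m n) (w k) (w k))"
    by (subst sum.swap) (simp add: sesq_one mult.commute)
  finally have tr: "mat_trace A = (\<Sum>k<n. sesq n (1\<^sub>m n) (w k) (w k))" .
  have "sesq n A x x
      = (\<Sum>k<n. sesq n (1\<^sub>m n) x (w k) * cnj (sesq n (1\<^sub>m n) x (w k)))"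
    by (subst sesq_gram[OF w]) (auto simp: sesq_one)
  also have "\<dots> \<le> (\<Sum>k<n. sesq n (1\<^sub>m n) x x * sesq n (1\<^sub>m n) (w k) (w k))"
    by (intro sum_mono psd_Cauchy_Schwarz(2) psd_one)
  finally show ?thesis by (simp add: tr sum_distrib_left mult.commute)
qed

text \<open>Evaluating the form of \<open>A\<^sup>T\<close> at \<open>x\<close> is evaluating that of \<open>A\<close> at the conjugate of \<open>x\<close>, a vector of
  the same norm. Both values are therefore between \<open>0\<close> and \<open>tr A \<parallel>x\<parallel>\<^sup>2\<close>, and \<open>\<lambda> \<ge> - 1/2\<close> weighs
  their sum against one copy of the upper bound.\<close>

lemma psd_trace_plus_transpose:
  assumes A: "psd n A" and lam: "lam \<ge> - (1 / 2)"
  shows "psd n (mat_trace A \<cdot>\<^sub>m 1\<^sub>m n + complex_of_real lam \<cdot>\<^sub>m (A + transpose_mat A))"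
proof -
  note car = psd_carrier[OF A]
  have "0 \<le> sesq n (mat_trace A \<cdot>\<^sub>m 1\<^sub>m n + complex_of_real lam \<cdot>\<^sub>m (A + transpose_mat A)) x x" for x
  proof -
    let ?y = "\<lambda>i. cnj (x i)"
    define t where "t = mat_trace A * sesq n (1\<^sub>m n) x x"
    define p where "p = sesq n A x x"
    define q where "q = sesq n A ?y ?y"
    have "sesq n (1\<^sub>m n) ?y ?y = sesq n (1\<^sub>m n) x x"
      by (simp add: sesq_one mult.commute)
    then have *: "p \<le> t" "q \<le> t" "0 \<le> p" "0 \<le> q"
      using sesq_le_trace[OF A, of x] sesq_le_trace[OF A, of ?y] A
      by (auto simp: p_def q_def t_def psd_iff_sesq)
    define r where "r = Re p + Re q"
    have "- (1 / 2) * r \<le> lam * r"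
      using * lam by (intro mult_right_mono) (auto simp: r_def less_eq_complex_def)
    moreover have "(1 / 2) * r \<le> Re t"
      using * by (auto simp: r_def less_eq_complex_def)
    ultimately have "0 \<le> Re t + lam * (Re p + Re q)"
      unfolding r_def [symmetric] by linarith
    moreover have "sesq n (mat_trace A \<cdot>\<^sub>m 1\<^sub>m n + complex_of_real lam \<cdot>\<^sub>m (A + transpose_mat A)) x x
      = t + complex_of_real lam * (p + q)"
      using car by (simp add: sesq_add_mat sesq_smult_mat sesq_transpose t_def p_def q_def)
    ultimately show ?thesis using * by (simp add: less_eq_complex_def)
  qed
  then show ?thesis using car by (simp add: psd_iff_sesq)
qed

section \<open>The Choi matrix of an entanglement breaking map\<close>

lemma index_finsum_mat:
  assumes "finite K" "\<And>k. k \<in> K \<Longrightarrow> X k \<in> carrier_mat n n" "i < n" "j < n"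
  shows "(\<Oplus>\<^bsub>Mats n\<^esub> k \<in> K. X k) $$ (i, j) = (\<Sum>k\<in>K. X k $$ (i, j))"
proof -
  interpret M: vectorspace class_ring "Mats n" by (rule matrix_vs)
  have "(\<Oplus>\<^bsub>Mats n\<^esub> k \<in> K. X k) \<in> carrier_mat n n \<and>
        (\<Oplus>\<^bsub>Mats n\<^esub> k \<in> K. X k) $$ (i, j) = (\<Sum>k\<in>K. X k $$ (i, j))"
    using assms
  proof (induction K rule: finite_induct)
    case empty
    then show ?case by (simp add: module_mat_simps)
  next
    case (insert a K)
    have "(\<Oplus>\<^bsub>Mats n\<^esub> k \<in> insert a K. X k) = X a + (\<Oplus>\<^bsub>Mats n\<^esub> k \<in> K. X k)"
      using insert by (subst M.M.finsum_insert) (auto simp: module_mat_simps)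
    then show ?case using insert by (auto simp: carrier_matD)
  qed
  then show ?thesis by simp
qed

lemma mat_unit_carrier: "mat_unit d a b \<in> carrier_mat d d"
  by (simp add: mat_unit_def)

lemma transpose_mat_unit: "transpose_mat (mat_unit d a b) = mat_unit d b a"
  by (intro eq_matI) (auto simp: mat_unit_def)

text \<open>The double sum collapses: in the entry \<open>(p, q)\<close> only the summand whose matrix unit sits at the
  block position \<open>(p div d, q div d)\<close> contributes.\<close>

lemma choi_eq_blocks:
  assumes \<Psi>: "\<And>a b. \<Psi> (mat_unit d a b) \<in> carrier_mat d d"
  shows "choi d \<Psi> = mat (d * d) (d * d)
    (\<lambda>(p, q). \<Psi> (mat_unit d (p div d) (q div d)) $$ (p mod d, q mod d))"
proof -
  have car: "mat_unit d a b \<otimes>\<^sub>m \<Psi> (mat_unit d a b) \<in> carrier_mat (d * d) (d * d)" for a b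
    using \<Psi>[of a b] by (auto simp: kron_def mat_unit_def)
  interpret M: vectorspace class_ring "Mats (d * d)" by (rule matrix_vs)
  have inner: "(\<Oplus>\<^bsub>Mats (d * d)\<^esub> j \<in> {..<d}. mat_unit d a j \<otimes>\<^sub>m \<Psi> (mat_unit d a j))
      \<in> carrier_mat (d * d) (d * d)" for a
    using M.M.finsum_closed[of "\<lambda>j. mat_unit d a j \<otimes>\<^sub>m \<Psi> (mat_unit d a j)" "{..<d}"] car
    by (auto simp: module_mat_simps)
  have closed: "choi d \<Psi> \<in> carrier_mat (d * d) (d * d)"
    unfolding choi_def using M.M.finsum_closed[of "\<lambda>a. \<Oplus>\<^bsub>Mats (d * d)\<^esub> j \<in> {..<d}.
      mat_unit d a j \<otimes>\<^sub>m \<Psi> (mat_unit d a j)" "{..<d}"] inner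
    by (auto simp: module_mat_simps)
  show ?thesis
  proof (rule eq_matI)
    fix p q assume "p < dim_row (mat (d * d) (d * d)
      (\<lambda>(p, q). \<Psi> (mat_unit d (p div d) (q div d)) $$ (p mod d, q mod d)))"
      "q < dim_col (mat (d * d) (d * d)
      (\<lambda>(p, q). \<Psi> (mat_unit d (p div d) (q div d)) $$ (p mod d, q mod d)))"
    then have pq: "p < d * d" "q < d * d" by auto
    have entry: "(mat_unit d a b \<otimes>\<^sub>m \<Psi> (mat_unit d a b)) $$ (p, q) =
      (if b = q div d then
        (if a = p div d then \<Psi> (mat_unit d (p div d) (q div d)) $$ (p mod d, q mod d) else 0)
       else 0)" for a b
      using pq \<Psi>[of a b] div_mod_less[OF pq(1)] div_mod_less[OF pq(2)]
      by (auto simp: kron_def mat_unit_def)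
    have "choi d \<Psi> $$ (p, q)
        = (\<Sum>a<d. \<Sum>b<d. (mat_unit d a b \<otimes>\<^sub>m \<Psi> (mat_unit d a b)) $$ (p, q))"
      unfolding choi_def using pq car inner by (simp add: index_finsum_mat)
    also have "\<dots> = \<Psi> (mat_unit d (p div d) (q div d)) $$ (p mod d, q mod d)"
      using div_mod_less[OF pq(1)] div_mod_less[OF pq(2)] by (simp add: entry)
    finally show "choi d \<Psi> $$ (p, q) = mat (d * d) (d * d)
      (\<lambda>(p, q). \<Psi> (mat_unit d (p div d) (q div d)) $$ (p mod d, q mod d)) $$ (p, q)"
      using pq by simp
  qed (use closed in auto)
qed

lemma choi_eq_id_tensor:
  assumes \<Phi>: "linear_map_mat d d \<Phi>"
  shows "choi d \<Phi> = id_tensor d d \<Phi> (choi d id)"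
proof -
  have "block d (choi d id) a b = mat_unit d a b" if "a < d" "b < d" for a b
    using that by (intro eq_matI)
      (auto simp: choi_eq_blocks mat_unit_carrier block_def mult_add_less mat_unit_def)
  then show ?thesis
    using \<Phi> by (subst choi_eq_blocks)
      (auto simp: id_tensor_def linear_map_mat_iff mat_unit_carrier div_mod_less intro!: eq_matI)
qed

text \<open>The Choi matrix of the identity is the rank one matrix \<open>\<Omega> \<Omega>\<^sup>*\<close>, where
  \<open>\<Omega> = \<Sum>\<^sub>a e\<^sub>a \<otimes> e\<^sub>a\<close> is the unnormalised maximally entangled vector.\<close>

lemma psd_choi_id: "psd (d * d) (choi d id)"
proof (rule gram_imp_psd)
  show "choi d id \<in> carrier_mat (d * d) (d * d)"
    by (simp add: choi_eq_blocks mat_unit_carrier)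
  fix p q assume pq: "p < d * d" "q < d * d"
  show "choi d id $$ (p, q) = (\<Sum>k\<in>{()}. (\<lambda>_ p. if p div d = p mod d then 1 else 0) k p
      * cnj ((\<lambda>_ p. if p div d = p mod d then 1 else 0) k q))"
    using pq by (auto simp: choi_eq_blocks mat_unit_carrier mat_unit_def div_mod_less)
qed

text \<open>The measure-and-prepare form of an entanglement breaking map, with each matrix unit in place of
  the argument. It is the separability of the Choi matrix read entry by entry.\<close>

lemma entanglement_breaking_Holevo:
  assumes eb: "entanglement_breaking d \<Phi>"
  obtains r :: nat and A B :: "nat \<Rightarrow> complex mat"
  where "\<And>k. k < r \<Longrightarrow> psd d (A k)" "\<And>k. k < r \<Longrightarrow> psd d (B k)"
    and "\<And>a b i j. a < d \<Longrightarrow> b < d \<Longrightarrow> i < d \<Longrightarrow> j < d \<Longrightarrow>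
      \<Phi> (mat_unit d a b) $$ (i, j) = (\<Sum>k<r. A k $$ (a, b) * B k $$ (i, j))"
proof (cases "d = 0")
  case True
  \<comment> \<open>Entanglement breaking speaks of \<open>m \<ge> 1\<close> only, so \<open>m = d\<close> is unavailable here; the claim is vacuous.\<close>
  then show ?thesis using that[of 0] by auto
next
  case False
  have \<Phi>: "linear_map_mat d d \<Phi>" using eb by (simp add: entanglement_breaking_def)
  have "separable d d (choi d \<Phi>)"
    unfolding choi_eq_id_tensor[OF \<Phi>]
    using eb False psd_choi_id by (simp add: entanglement_breaking_def)
  then obtain r :: nat and A B where AB: "\<And>k. k < r \<Longrightarrow> psd d (A k)" "\<And>k. k < r \<Longrightarrow> psd d (B k)"
    and C: "choi d \<Phi> = (\<Oplus>\<^bsub>Mats (d * d)\<^esub> k \<in> {..<r}. A k \<otimes>\<^sub>m B k)"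
    unfolding separable_def by blast
  have "\<Phi> (mat_unit d a b) $$ (i, j) = (\<Sum>k<r. A k $$ (a, b) * B k $$ (i, j))"
    if *: "a < d" "b < d" "i < d" "j < d" for a b i j
  proof -
    have pq: "a * d + i < d * d" "b * d + j < d * d" using * by (auto simp: mult_add_less)
    have "\<Phi> (mat_unit d a b) $$ (i, j) = choi d \<Phi> $$ (a * d + i, b * d + j)"
      using * pq \<Phi> by (subst choi_eq_blocks) (auto simp: linear_map_mat_iff mat_unit_carrier)
    also have "\<dots> = (\<Sum>k<r. (A k \<otimes>\<^sub>m B k) $$ (a * d + i, b * d + j))"
      unfolding C using pq psd_kron[OF AB, THEN psd_carrier] by (intro index_finsum_mat) auto
    also have "\<dots> = (\<Sum>k<r. A k $$ (a, b) * B k $$ (i, j))"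
    proof (intro sum.cong refl)
      fix k assume "k \<in> {..<r}"
      then show "(A k \<otimes>\<^sub>m B k) $$ (a * d + i, b * d + j) = A k $$ (a, b) * B k $$ (i, j)"
        using * pq AB[of k, THEN psd_carrier] by (simp add: kron_def)
    qed
    finally show ?thesis .
  qed
  then show ?thesis using that AB by blast
qed

text \<open>The identity is the sum of the diagonal matrix units; the partial sums are the projections
  \<open>P m\<close> onto the first \<open>m\<close> coordinates.\<close>

lemma linear_map_mat_one:
  assumes \<Phi>: "linear_map_mat d d \<Phi>" and ij: "i < d" "j < d"
  shows "\<Phi> (1\<^sub>m d) $$ (i, j) = (\<Sum>a<d. \<Phi> (mat_unit d a a) $$ (i, j))"
proof -
  note lin = \<Phi>[unfolded linear_map_mat_iff]
  define P where "P m = mat d d (\<lambda>(k, l). if k = l \<and> k < m then 1 else 0 :: complex)" for m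
  have P: "P m \<in> carrier_mat d d" for m by (simp add: P_def)
  have "\<Phi> (P m) $$ (i, j) = (\<Sum>a<m. \<Phi> (mat_unit d a a) $$ (i, j))" if "m \<le> d" for m
    using that
  proof (induction m)
    case 0
    have "P 0 = 0 \<cdot>\<^sub>m 1\<^sub>m d" by (intro eq_matI) (auto simp: P_def)
    then have "\<Phi> (P 0) = 0 \<cdot>\<^sub>m \<Phi> (1\<^sub>m d)" using lin by simp
    moreover have "\<Phi> (1\<^sub>m d) \<in> carrier_mat d d" using lin by simp
    ultimately show ?case using ij by simp
  next
    case (Suc m)
    have "P (Suc m) = P m + mat_unit d m m"
      by (intro eq_matI) (auto simp: P_def mat_unit_def)
    then have "\<Phi> (P (Suc m)) = \<Phi> (P m) + \<Phi> (mat_unit d m m)"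
      using lin P mat_unit_carrier by simp
    moreover have "\<Phi> (mat_unit d m m) \<in> carrier_mat d d" using lin mat_unit_carrier by blast
    ultimately show ?case using Suc ij by simp
  qed
  moreover have "P d = 1\<^sub>m d" by (intro eq_matI) (auto simp: P_def)
  ultimately show ?thesis by (metis order_refl)
qed

theorem corollary4p16:
  fixes d :: nat and \<Phi> :: "complex mat \<Rightarrow> complex mat" and lam :: real
  assumes "completely_positive d \<Phi>"
    and "entanglement_breaking d \<Phi>"
    and "lam \<ge> - (1 / 2)"
  shows "psd (d * d) ((1\<^sub>m d \<otimes>\<^sub>m \<Phi> (1\<^sub>m d))
           + complex_of_real lam \<cdot>\<^sub>m (choi d \<Phi> + choi d (\<Phi> \<circ> transpose_mat)))
       \<and> psd (d * d) ((tr2 d d (choi d \<Phi>) \<otimes>\<^sub>m 1\<^sub>m d)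
           + complex_of_real lam \<cdot>\<^sub>m (choi d \<Phi> + choi d (transpose_mat \<circ> \<Phi>)))"
proof -
  have lin: "linear_map_mat d d \<Phi>" using assms(2) by (simp add: entanglement_breaking_def)
  have car: "\<Phi> (mat_unit d a b) \<in> carrier_mat d d" "\<Phi> (1\<^sub>m d) \<in> carrier_mat d d" for a b
    using lin by (auto simp: linear_map_mat_iff mat_unit_carrier)
  obtain r :: nat and A B where A: "\<And>k. k < r \<Longrightarrow> psd d (A k)" and B: "\<And>k. k < r \<Longrightarrow> psd d (B k)"
    and unit: "\<And>a b i j. a < d \<Longrightarrow> b < d \<Longrightarrow> i < d \<Longrightarrow> j < d \<Longrightarrow>
      \<Phi> (mat_unit d a b) $$ (i, j) = (\<Sum>k<r. A k $$ (a, b) * B k $$ (i, j))"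
    using entanglement_breaking_Holevo[OF assms(2)] by blast
  note carA = A[THEN psd_carrier] and carB = B[THEN psd_carrier]
  have choi1: "choi d \<Phi> = mat (d * d) (d * d)
      (\<lambda>(p, q). \<Phi> (mat_unit d (p div d) (q div d)) $$ (p mod d, q mod d))"
    by (rule choi_eq_blocks) (rule car)
  have choi2: "choi d (\<Phi> \<circ> transpose_mat) = mat (d * d) (d * d)
      (\<lambda>(p, q). \<Phi> (mat_unit d (q div d) (p div d)) $$ (p mod d, q mod d))"
    by (subst choi_eq_blocks) (simp_all add: car transpose_mat_unit)
  have choi3: "choi d (transpose_mat \<circ> \<Phi>) = mat (d * d) (d * d)
      (\<lambda>(p, q). transpose_mat (\<Phi> (mat_unit d (p div d) (q div d))) $$ (p mod d, q mod d))"
    by (subst choi_eq_blocks) (simp_all add: car)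
  have one: "\<Phi> (1\<^sub>m d) $$ (i, j) = (\<Sum>k<r. mat_trace (A k) * B k $$ (i, j))"
    if "i < d" "j < d" for i j
  proof -
    have "\<Phi> (1\<^sub>m d) $$ (i, j) = (\<Sum>a<d. \<Sum>k<r. A k $$ (a, a) * B k $$ (i, j))"
      using that by (simp add: linear_map_mat_one[OF lin that] unit)
    also have "\<dots> = (\<Sum>k<r. \<Sum>a<d. A k $$ (a, a) * B k $$ (i, j))"
      by (rule sum.swap)
    also have "\<dots> = (\<Sum>k<r. mat_trace (A k) * B k $$ (i, j))"
      using carA by (intro sum.cong) (auto simp: mat_trace_def sum_distrib_right)
    finally show ?thesis .
  qed
  have trace: "tr2 d d (choi d \<Phi>) $$ (a, b) = (\<Sum>k<r. mat_trace (B k) * A k $$ (a, b))"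
    if "a < d" "b < d" for a b
  proof -
    have "tr2 d d (choi d \<Phi>) $$ (a, b) = (\<Sum>i<d. \<Sum>k<r. A k $$ (a, b) * B k $$ (i, i))"
      using that by (simp add: tr2_def mat_trace_def block_def choi1 mult_add_less unit)
    also have "\<dots> = (\<Sum>k<r. \<Sum>i<d. A k $$ (a, b) * B k $$ (i, i))"
      by (rule sum.swap)
    also have "\<dots> = (\<Sum>k<r. mat_trace (B k) * A k $$ (a, b))"
      using carB by (intro sum.cong) (auto simp: mat_trace_def sum_distrib_left mult.commute)
    finally show ?thesis .
  qed
  have "psd (d * d) ((1\<^sub>m d \<otimes>\<^sub>m \<Phi> (1\<^sub>m d))
           + complex_of_real lam \<cdot>\<^sub>m (choi d \<Phi> + choi d (\<Phi> \<circ> transpose_mat)))"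
  proof (rule psd_sum_of_psd)
    let ?X = "\<lambda>k. (mat_trace (A k) \<cdot>\<^sub>m 1\<^sub>m d
      + complex_of_real lam \<cdot>\<^sub>m (A k + transpose_mat (A k))) \<otimes>\<^sub>m B k"
    show "psd (d * d) (?X k)" if "k < r" for k
      by (intro psd_kron psd_trace_plus_transpose A B that assms(3))
    fix p q assume pq: "p < d * d" "q < d * d"
    note dm = div_mod_less[OF pq(1)] div_mod_less[OF pq(2)]
    show "((1\<^sub>m d \<otimes>\<^sub>m \<Phi> (1\<^sub>m d))
        + complex_of_real lam \<cdot>\<^sub>m (choi d \<Phi> + choi d (\<Phi> \<circ> transpose_mat))) $$ (p, q)
      = (\<Sum>k<r. ?X k $$ (p, q))"
    proof -
      have "?X k $$ (p, q) = 1\<^sub>m d $$ (p div d, q div d) * (mat_trace (A k) * B k $$ (p mod d, q mod d))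
          + complex_of_real lam * (A k $$ (p div d, q div d) * B k $$ (p mod d, q mod d)
            + A k $$ (q div d, p div d) * B k $$ (p mod d, q mod d))" if "k < r" for k
        using carA[OF that] carB[OF that] pq dm by (simp add: kron_def algebra_simps)
      then show ?thesis
        using pq dm car(2) carrier_matD[OF car(2)]
        by (simp add: kron_def choi1 choi2 one unit sum.distrib sum_distrib_left distrib_left)
    qed
  qed (use car(2) in \<open>auto simp: choi1 choi2 kron_def\<close>)
  moreover have "psd (d * d) ((tr2 d d (choi d \<Phi>) \<otimes>\<^sub>m 1\<^sub>m d)
           + complex_of_real lam \<cdot>\<^sub>m (choi d \<Phi> + choi d (transpose_mat \<circ> \<Phi>)))"
  proof (rule psd_sum_of_psd)
    let ?X = "\<lambda>k. A k \<otimes>\<^sub>m (mat_trace (B k) \<cdot>\<^sub>m 1\<^sub>m d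
      + complex_of_real lam \<cdot>\<^sub>m (B k + transpose_mat (B k)))"
    show "psd (d * d) (?X k)" if "k < r" for k
      by (intro psd_kron psd_trace_plus_transpose A B that assms(3))
    fix p q assume pq: "p < d * d" "q < d * d"
    note dm = div_mod_less[OF pq(1)] div_mod_less[OF pq(2)]
    have tr: "tr2 d d (choi d \<Phi>) \<in> carrier_mat d d" by (simp add: tr2_def)
    show "((tr2 d d (choi d \<Phi>) \<otimes>\<^sub>m 1\<^sub>m d)
        + complex_of_real lam \<cdot>\<^sub>m (choi d \<Phi> + choi d (transpose_mat \<circ> \<Phi>))) $$ (p, q)
      = (\<Sum>k<r. ?X k $$ (p, q))"
    proof -
      have "?X k $$ (p, q) = mat_trace (B k) * A k $$ (p div d, q div d) * 1\<^sub>m d $$ (p mod d, q mod d)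
          + complex_of_real lam * (A k $$ (p div d, q div d) * B k $$ (p mod d, q mod d)
            + A k $$ (p div d, q div d) * B k $$ (q mod d, p mod d))" if "k < r" for k
        using carA[OF that] carB[OF that] pq dm by (simp add: kron_def algebra_simps)
      moreover have "(tr2 d d (choi d \<Phi>) \<otimes>\<^sub>m 1\<^sub>m d) $$ (p, q)
          = tr2 d d (choi d \<Phi>) $$ (p div d, q div d) * 1\<^sub>m d $$ (p mod d, q mod d)"
        using tr pq by (simp add: kron_def)
      moreover have "tr2 d d (choi d \<Phi>) \<otimes>\<^sub>m 1\<^sub>m d \<in> carrier_mat (d * d) (d * d)"
        using tr by (auto simp: kron_def)
      moreover have "choi d \<Phi> $$ (p, q) = (\<Sum>k<r. A k $$ (p div d, q div d) * B k $$ (p mod d, q mod d))"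
        using pq dm by (simp add: choi1 unit)
      moreover have "choi d (transpose_mat \<circ> \<Phi>) $$ (p, q)
          = (\<Sum>k<r. A k $$ (p div d, q div d) * B k $$ (q mod d, p mod d))"
        using pq dm carrier_matD[OF car(1)] by (simp add: choi3 unit)
      moreover have "choi d \<Phi> \<in> carrier_mat (d * d) (d * d)"
        "choi d (transpose_mat \<circ> \<Phi>) \<in> carrier_mat (d * d) (d * d)"
        by (simp_all add: choi1 choi3)
      ultimately show ?thesis
        using pq dm
        by (simp add: trace sum.distrib sum_distrib_left sum_distrib_right distrib_left
            del: index_one_mat)
    qed
  qed (auto simp: choi1 choi3 kron_def tr2_def)
  ultimately show ?thesis by blast
qed

end
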